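(* If an entire function $f$ (on some $\mathbb C^n$) of finite positive order has a proximate order $\rho$ satisfying the condition $$\liminf_{r\to\infty}\frac{m_f(r)}{r^{\rho(r)}}>0,$$ then $f\in\mathscr C$.
   Context: $\mathbb B^n_r\subset\mathbb C^n$ is the open Euclidean ball of radius $r$ centered at $0$. For an entire function $f$ on $\mathbb C^n$: $M_f(r):=\sup_{\mathbb B^n_r}|f|$, $m_f(r):=\ln M_f(r)$, the order is $\rho_f:=\limsup_{r\to\infty}\frac{\ln m_f(r)}{\ln r}$, and $\phi_f(t):=m_f(e^t)$, $t\in\mathbb R$. A function $\rho\in C^1(0,\infty)$ satisfying $\lim_{r\to\infty}\rho(r)=\rho_f$ and $\lim_{r\to\infty}r\rho'(r)\ln r=0$ is called a proximate order of $f$ if $\limsup_{r\to\infty}\frac{m_f(r)}{r^{\rho(r)}}\in(0,\infty)$. Class $\mathscr C$ consists of the nonpolynomial entire functions $f$ satisfying one of the following: (I) $\rho_f<\infty$ and $\limsup_{t\to\infty}\frac{\phi_f(t+1)-\phi_f(t)}{\phi_f(t)-\phi_f(t-1)}<\infty$; (II) $\rho_f=\infty$ and $\lim_{t\to\infty}t^2\left(\frac1{\ln\psi(t)}\right)'=0$ (limit over the points where $\psi'$ exists) for some convex increasing $\psi\in C(\mathbb R)$ with $\lim_{t\to\infty}\frac{\ln\psi(t)}{\ln\phi_f(t)}=1$. *)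

theory Defs
  imports "HOL-Analysis.Analysis"
begin

text \<open>Entire functions on \<open>\<complex>\<^sup>n\<close>, modelled as \<^typ>\<open>complex^'n\<close>: Frechet differentiability with a
  complex-linear derivative.  \<^const>\<open>has_derivative\<close> only gives real linearity, so compatibility
  with complex scalars is demanded separately.\<close>

definition is_entire :: "(complex^'n \<Rightarrow> complex) \<Rightarrow> bool" where
  "is_entire f \<longleftrightarrow>
     (\<forall>z. \<exists>D. (f has_derivative D) (at z) \<and> (\<forall>c v. D (c *s v) = c * D v))"

definition is_polynomial :: "(complex^'n \<Rightarrow> complex) \<Rightarrow> bool" where
  "is_polynomial f \<longleftrightarrow>
     (\<exists>(A :: ('n \<Rightarrow> nat) set) a. finite A \<and>
        (\<forall>z. f z = (\<Sum>\<alpha>\<in>A. a \<alpha> * (\<Prod>i\<in>UNIV. (z $ i) ^ \<alpha> i))))"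

text \<open>The norm of \<^typ>\<open>complex^'n\<close> is the Euclidean norm, so \<^term>\<open>ball 0 r\<close> is the open Euclidean
  ball.\<close>

definition max_modulus :: "(complex^'n \<Rightarrow> complex) \<Rightarrow> real \<Rightarrow> real" where
  "max_modulus f r = (SUP z\<in>ball 0 r. norm (f z))"

definition log_max_modulus :: "(complex^'n \<Rightarrow> complex) \<Rightarrow> real \<Rightarrow> real" where
  "log_max_modulus f r = ln (max_modulus f r)"

text \<open>For nonconstant entire \<open>f\<close> the argument of the outer logarithm is eventually positive; for
  constant \<open>f\<close> the totalised real logarithm makes the order 0.\<close>

definition growth_order :: "(complex^'n \<Rightarrow> complex) \<Rightarrow> ereal" where
  "growth_order f = Limsup at_top (\<lambda>r. ereal (ln (log_max_modulus f r) / ln r))"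

definition phi :: "(complex^'n \<Rightarrow> complex) \<Rightarrow> real \<Rightarrow> real" where
  "phi f t = log_max_modulus f (exp t)"

definition proximate_order :: "(complex^'n \<Rightarrow> complex) \<Rightarrow> (real \<Rightarrow> real) \<Rightarrow> bool" where
  "proximate_order f \<rho> \<longleftrightarrow>
     \<rho> C1_differentiable_on {0<..} \<and>
     ((\<lambda>r. ereal (\<rho> r)) \<longlongrightarrow> growth_order f) at_top \<and>
     ((\<lambda>r. r * deriv \<rho> r * ln r) \<longlongrightarrow> 0) at_top \<and>
     Limsup at_top (\<lambda>r. ereal (log_max_modulus f r / r powr \<rho> r)) \<in> {0<..<\<infinity>}"

definition class_C_I :: "(complex^'n \<Rightarrow> complex) \<Rightarrow> bool" where
  "class_C_I f \<longleftrightarrow>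
     growth_order f < \<infinity> \<and>
     Limsup at_top (\<lambda>t. ereal ((phi f (t + 1) - phi f t) / (phi f t - phi f (t - 1)))) < \<infinity>"

text \<open>The filter in the first limit restricts \<open>t \<rightarrow> \<infinity>\<close> to the points where \<open>\<psi>'\<close> exists.  The second
  limit forces, for nonconstant \<open>f\<close>, \<open>ln \<psi>\<close> to tend to infinity, so the logarithm and the quotient are eventually genuine.\<close>

definition class_C_II :: "(complex^'n \<Rightarrow> complex) \<Rightarrow> bool" where
  "class_C_II f \<longleftrightarrow>
     growth_order f = \<infinity> \<and>
     (\<exists>\<psi> :: real \<Rightarrow> real.
        continuous_on UNIV \<psi> \<and> convex_on UNIV \<psi> \<and> strict_mono \<psi> \<and>
        ((\<lambda>t. t\<^sup>2 * deriv (\<lambda>s. 1 / ln (\<psi> s)) t) \<longlongrightarrow> 0)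
          (inf at_top (principal {t. \<psi> differentiable (at t)})) \<and>
        ((\<lambda>t. ln (\<psi> t) / ln (phi f t)) \<longlongrightarrow> 1) at_top)"

definition class_C :: "(complex^'n \<Rightarrow> complex) set" where
  "class_C = {f. is_entire f \<and> \<not> is_polynomial f \<and> (class_C_I f \<or> class_C_II f)}"

end

theory Submission
  imports Defs "HOL-Complex_Analysis.Conformal_Mappings" "HOL-Real_Asymp.Real_Asymp"
begin

text \<open>Write \<open>V t = exp (t * \<rho> (exp t))\<close>.  The hypotheses on \<open>\<rho>\<close> say that \<open>ln V\<close> has derivative tending
  to the order of \<open>f\<close>, and that \<open>phi f\<close> lies between two positive multiples of \<open>V\<close>.  Hence
  \<open>phi f (t + 1) - phi f t\<close> is at most a multiple of \<open>V t\<close>, while \<open>phi f t - phi f (t - k)\<close> is at least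
  a multiple of \<open>V t\<close> once \<open>k\<close> is large.  To pass from \<open>k\<close> to \<open>1\<close> one uses convexity of \<open>phi f\<close>
  (Hadamard's three circles theorem).  An additive error is harmless because \<open>V\<close> tends to infinity,
  so it is enough to apply the maximum principle on an annulus to \<open>f z / z ^ p\<close> with an integer \<open>p\<close>,
  along each complex line through the origin.\<close>

section \<open>Entire functions on complex lines and the maximum modulus\<close>

lemma norm_vector_smult_complex:
  fixes v :: "complex^'n"
  shows "norm (c *s v) = norm c * norm v"
  by (simp add: norm_vec_def norm_mult L2_set_right_distrib)

lemma is_entire_continuous_on:
  assumes "is_entire f"
  shows "continuous_on S f"
  using assms unfolding is_entire_def
  by (metis continuous_at_imp_continuous_on has_derivative_continuous)

text \<open>Complex homogeneity of \<open>D\<close> turns \<open>D (h *s u)\<close> into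
  \<open>D u * h\<close>, so the chain rule gives a complex derivative.\<close>

lemma is_entire_on_complex_line:
  assumes "is_entire f"
  shows "(\<lambda>w. f (w *s u)) holomorphic_on S"
proof -
  have "(\<lambda>w. f (w *s u)) field_differentiable (at w)" for w
  proof -
    obtain D where D: "(f has_derivative D) (at (w *s u))" and lin: "\<And>c v. D (c *s v) = c * D v"
      using assms unfolding is_entire_def by blast
    have "bounded_linear (\<lambda>h. h *s u)"
    proof (rule bounded_linear_intro[where K = "norm u"])
      show "(r *\<^sub>R h) *s u = r *\<^sub>R (h *s u)" for r h
        by (simp add: vec_eq_iff)
    qed (simp_all add: vector_sadd_rdistrib norm_vector_smult_complex)
    then have "((\<lambda>h. h *s u) has_derivative (\<lambda>h. h *s u)) (at w)"
      by (rule bounded_linear_imp_has_derivative)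
    from has_derivative_compose[OF this D]
    have "((\<lambda>w. f (w *s u)) has_derivative (\<lambda>h. D u * h)) (at w)"
      by (simp add: lin mult.commute)
    then show ?thesis
      by (auto simp: field_differentiable_def has_field_derivative_def)
  qed
  then show ?thesis
    by (simp add: holomorphic_on_def field_differentiable_at_within)
qed

text \<open>The supremum is taken over the open ball; continuity carries the bound to the closure,
  which the circle estimates below require.\<close>

lemma norm_le_max_modulus:
  assumes "is_entire f" "0 < r" "norm z \<le> r"
  shows "norm (f z) \<le> max_modulus f r"
proof -
  have "bounded (f ` cball 0 r)"
    by (intro compact_imp_bounded compact_continuous_image is_entire_continuous_on[OF assms(1)] compact_cball)
  then obtain B where "\<And>z. norm z \<le> r \<Longrightarrow> norm (f z) \<le> B"
    unfolding bounded_iff by force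
  then have "bdd_above ((\<lambda>z. norm (f z)) ` ball 0 r)"
    by (intro bdd_aboveI2[where M = B]) simp
  then have "\<forall>y\<in>ball 0 r. norm (f y) \<le> max_modulus f r"
    unfolding max_modulus_def by (auto intro: cSUP_upper)
  then show ?thesis
    using assms
    by (intro continuous_on_closure_norm_le[where s = "ball 0 r"] is_entire_continuous_on) auto
qed

lemma max_modulus_least:
  assumes "0 < r" "\<And>z. norm z < r \<Longrightarrow> norm (f z) \<le> B"
  shows "max_modulus f r \<le> B"
  unfolding max_modulus_def using assms by (intro cSUP_least) auto

lemma max_modulus_nonneg:
  assumes "is_entire f" "0 < r"
  shows "0 \<le> max_modulus f r"
  using norm_le_max_modulus[OF assms, of 0] assms(2) by (simp add: order_trans[OF norm_ge_zero])

lemma max_modulus_mono: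
  assumes "is_entire f" "0 < r" "r \<le> s"
  shows "max_modulus f r \<le> max_modulus f s"
  using assms by (intro max_modulus_least norm_le_max_modulus) auto

section \<open>Three circles with integer exponents\<close>

lemma norm_le_power_on_annulus:
  fixes g :: "complex \<Rightarrow> complex"
  assumes hol: "g holomorphic_on UNIV" and "0 < a"
    and inner: "\<And>z. norm z = a \<Longrightarrow> norm (g z) \<le> C * a ^ p"
    and outer: "\<And>z. norm z = R \<Longrightarrow> norm (g z) \<le> C * R ^ p"
    and z: "a \<le> norm z" "norm z \<le> R"
  shows "norm (g z) \<le> C * norm z ^ p"
proof -
  define S :: "complex set" where "S = cball 0 R - ball 0 a"
  have S: "closed S" "bounded S" and nz: "\<And>w. w \<in> S \<Longrightarrow> w \<noteq> 0"
    using \<open>0 < a\<close> by (auto simp: S_def closed_Diff bounded_diff)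
  have holS: "(\<lambda>w. g w / w ^ p) holomorphic_on S"
    using nz by (intro holomorphic_intros holomorphic_on_subset[OF hol]) auto
  have "norm (g z / z ^ p) \<le> C"
  proof (rule maximum_modulus_frontier[where S = S and f = "\<lambda>w. g w / w ^ p" and \<xi> = z])
    show "(\<lambda>w. g w / w ^ p) holomorphic_on interior S"
      using holS interior_subset holomorphic_on_subset by blast
    show "continuous_on (closure S) (\<lambda>w. g w / w ^ p)"
      using holS S holomorphic_on_imp_continuous_on by simp
  next
    fix w assume w: "w \<in> frontier S"
    \<comment> \<open>The closed set \<open>S\<close> contains its frontier, and the open annulus is
      interior to \<open>S\<close>, so frontier points lie on the two bounding circles.\<close>
    have "ball 0 R - cball 0 a \<subseteq> interior S"
      by (rule interior_maximal) (auto simp: S_def open_Diff)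
    with w S have "w \<in> S" "w \<notin> ball 0 R - cball 0 a"
      by (auto simp: frontier_def)
    then have "norm w = a \<or> norm w = R" "w \<noteq> 0"
      using nz by (auto simp: S_def)
    then show "norm (g w / w ^ p) \<le> C"
      using inner outer by (auto simp: norm_divide norm_power divide_le_eq)
  qed (use S z in \<open>auto simp: S_def\<close>)
  moreover have "0 < norm z"
    using z \<open>0 < a\<close> by linarith
  ultimately show ?thesis
    by (simp add: norm_divide norm_power divide_le_eq)
qed

text \<open>The monomial \<open>C * r ^ p\<close> that equals the maximum modulus at
  \<open>R\<close> dominates it at \<open>a\<close> by \<open>le\<close>, hence also in between. For
  positive moduli this says: if the chord of \<open>ln M\<close> against \<open>ln r\<close> over
  \<open>[a, R]\<close> has slope at least \<open>p\<close>, so has the chord over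
  \<open>[s, R]\<close>.\<close>

lemma max_modulus_three_circles:
  assumes f: "is_entire f" and r: "0 < a" "a \<le> s" "s \<le> R"
    and le: "max_modulus f a * R ^ p \<le> max_modulus f R * a ^ p"
  shows "max_modulus f s * R ^ p \<le> max_modulus f R * s ^ p"
proof -
  define C where "C = max_modulus f R / R ^ p"
  have C: "0 \<le> C" "max_modulus f R = C * R ^ p" "max_modulus f a \<le> C * a ^ p"
    using le r max_modulus_nonneg[OF f, of R] by (auto simp: C_def field_simps)
  have "max_modulus f s \<le> C * s ^ p"
  proof (rule max_modulus_least)
    fix v :: "complex^'a" assume v: "norm v < s"
    show "norm (f v) \<le> C * s ^ p"
    \<comment> \<open>The ball of radius \<open>s\<close> contains the hole of the annulus; there
      the bound at radius \<open>a\<close> suffices.\<close>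
    proof (cases "norm v \<le> a")
      case True
      then have "norm (f v) \<le> C * a ^ p"
        using norm_le_max_modulus[OF f _ True] r C by linarith
      also have "\<dots> \<le> C * s ^ p"
        using C r by (intro mult_left_mono power_mono) auto
      finally show ?thesis .
    next
      case False
      \<comment> \<open>For a unit vector \<open>u\<close>, circles in the \<open>w\<close>-plane
        map into spheres of the same radius.\<close>
      define u where "u = complex_of_real (inverse (norm v)) *s v"
      have u: "norm u = 1" "complex_of_real (norm v) *s u = v"
      proof -
        have "norm v \<noteq> 0"
          using False r by linarith
        then show "norm u = 1" "complex_of_real (norm v) *s u = v"
          by (simp_all add: u_def norm_vector_smult_complex vector_smult_assoc norm_inverse)
      qed
      have bd: "norm (f (w *s u)) \<le> max_modulus f (norm w)" if "norm w > 0" for w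
        using that u by (intro norm_le_max_modulus f) (auto simp: norm_vector_smult_complex)
      have "norm (f (complex_of_real (norm v) *s u)) \<le> C * norm (complex_of_real (norm v)) ^ p"
      proof (rule norm_le_power_on_annulus[where a = a and R = R])
        show "(\<lambda>w. f (w *s u)) holomorphic_on UNIV"
          by (rule is_entire_on_complex_line[OF f])
        show "norm (f (w *s u)) \<le> C * a ^ p" if "norm w = a" for w
          using bd[of w] that r C by auto
        show "norm (f (w *s u)) \<le> C * R ^ p" if "norm w = R" for w
          using bd[of w] that r C by auto
      qed (use False v r in auto)
      also have "\<dots> \<le> C * s ^ p"
        using C v by (intro mult_left_mono power_mono) auto
      finally show ?thesis
        using u by simp
    qed
  qed (use r in auto)
  then show ?thesis
    using C(2) r by (simp add: mult.commute mult.left_commute mult_left_mono)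
qed

text \<open>By convexity the last unit increment is at least the mean slope over \<open>k\<close>
  units; rounding that slope down to an integer costs at most 1.\<close>

lemma phi_increment_ge:
  assumes f: "is_entire f" and pos: "0 < max_modulus f (exp (t - real k))" and k: "0 < k"
  shows "(phi f t - phi f (t - real k)) / real k - 1 \<le> phi f t - phi f (t - 1)"
proof -
  define x where "x = (phi f t - phi f (t - real k)) / real k"
  define p where "p = nat \<lfloor>x\<rfloor>"
  have pos': "0 < max_modulus f (exp s)" if "t - real k \<le> s" for s
    using pos max_modulus_mono[OF f, of "exp (t - real k)" "exp s"] that by simp
  have M: "max_modulus f (exp s) = exp (phi f s)" if "t - real k \<le> s" for s
    using pos'[OF that] by (simp add: phi_def log_max_modulus_def)
  \<comment> \<open>Monotonicity gives \<open>0 \<le> x\<close>, so \<open>nat\<close> does not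
    change the floor.\<close>
  have "exp (phi f (t - real k)) \<le> exp (phi f t)"
    using max_modulus_mono[OF f, of "exp (t - real k)" "exp t"] k by (simp add: M)
  then have "0 \<le> x"
    by (simp add: x_def)
  then have p: "real p \<le> x" "x - 1 \<le> real p"
    unfolding p_def by linarith+
  \<comment> \<open>This is the logarithm of the three circles premise for the radii
    \<open>exp (t - k)\<close> and \<open>exp t\<close>.\<close>
  have "phi f (t - real k) + real p * t \<le> phi f t + real p * (t - real k)"
    using p(1) k by (simp add: x_def field_simps)
  then have "max_modulus f (exp (t - real k)) * exp t ^ p \<le> max_modulus f (exp t) * exp (t - real k) ^ p"
    using k by (simp add: M flip: exp_of_nat_mult exp_add)
  from max_modulus_three_circles[OF f _ _ _ this, of "exp (t - 1)"]
  have "max_modulus f (exp (t - 1)) * exp t ^ p \<le> max_modulus f (exp t) * exp (t - 1) ^ p"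
    using k by simp
  then have "phi f (t - 1) + real p * t \<le> phi f t + real p * (t - 1)"
    using k by (simp add: M flip: exp_of_nat_mult exp_add)
  with p show ?thesis
    by (simp add: x_def algebra_simps)
qed

section \<open>Growth of polynomials\<close>

lemma is_polynomial_phi_le:
  assumes f: "is_entire f" and poly: "is_polynomial f"
  obtains K d where "\<And>t. 0 \<le> t \<Longrightarrow> 0 < max_modulus f (exp t) \<Longrightarrow> phi f t \<le> K + d * t"
proof -
  obtain A :: "('a \<Rightarrow> nat) set" and a where A: "finite A"
    and eq: "\<And>z. f z = (\<Sum>\<alpha>\<in>A. a \<alpha> * (\<Prod>i\<in>UNIV. (z $ i) ^ \<alpha> i))"
    using poly unfolding is_polynomial_def by blast
  \<comment> \<open>The summand 1 keeps \<open>ln K\<close> genuine when all coefficients vanish.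
    Summing all degrees in \<open>d\<close> bounds every monomial and also covers empty
    \<open>A\<close>.\<close>
  define K where "K = (\<Sum>\<alpha>\<in>A. norm (a \<alpha>)) + 1"
  define d where "d = (\<Sum>\<alpha>\<in>A. \<Sum>i\<in>UNIV. \<alpha> i)"
  have K: "0 < K"
    by (simp add: K_def sum_nonneg add_nonneg_pos)
  have "phi f t \<le> ln K + real d * t" if t: "0 \<le> t" and pos: "0 < max_modulus f (exp t)" for t
  proof -
    have "max_modulus f (exp t) \<le> K * exp t ^ d"
    proof (rule max_modulus_least)
      fix z :: "complex^'a" assume z: "norm z < exp t"
      have "norm (f z) \<le> (\<Sum>\<alpha>\<in>A. norm (a \<alpha>) * exp t ^ d)"
        unfolding eq
      proof (intro sum_norm_le)
        fix \<alpha> assume "\<alpha> \<in> A"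
        have "norm (\<Prod>i\<in>UNIV. (z $ i) ^ \<alpha> i) = (\<Prod>i\<in>UNIV. norm (z $ i) ^ \<alpha> i)"
          by (simp only: norm_power flip: prod_norm)
        also have "\<dots> \<le> (\<Prod>i\<in>UNIV. exp t ^ \<alpha> i)"
          using z Finite_Cartesian_Product.norm_nth_le[of z]
          by (intro prod_mono conjI power_mono) (auto intro: order_trans less_imp_le)
        also have "\<dots> = exp t ^ (\<Sum>i\<in>UNIV. \<alpha> i)"
          by (simp add: power_sum)
        also have "\<dots> \<le> exp t ^ d"
          unfolding d_def using A \<open>\<alpha> \<in> A\<close> t by (intro power_increasing member_le_sum) auto
        finally show "norm (a \<alpha> * (\<Prod>i\<in>UNIV. (z $ i) ^ \<alpha> i)) \<le> norm (a \<alpha>) * exp t ^ d"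
          by (simp add: norm_mult mult_left_mono)
      qed
      also have "\<dots> \<le> K * exp t ^ d"
        by (simp add: K_def sum_distrib_right[symmetric] distrib_right)
      finally show "norm (f z) \<le> K * exp t ^ d" .
    qed simp
    then have "phi f t \<le> ln (K * exp t ^ d)"
      using pos K by (simp add: phi_def log_max_modulus_def)
    also have "\<dots> = ln K + real d * t"
      using K by (simp add: ln_mult ln_realpow)
    finally show ?thesis .
  qed
  then show ?thesis
    by (rule that)
qed

section \<open>The exponent of a proximate order\<close>

text \<open>With \<open>r = exp t\<close>, the derivative of \<open>g\<close> is
  \<open>\<rho> r + r * deriv \<rho> r * ln r\<close>, which tends to \<open>l\<close>. The mean
  value theorem turns the eventual bounds \<open>l / 2\<close> and \<open>2 * l\<close> into
  increments.\<close>

lemma proximate_exponent_increments: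
  fixes \<rho> :: "real \<Rightarrow> real"
  assumes C1: "\<rho> C1_differentiable_on {0<..}" and "0 < l"
    and lim: "(\<rho> \<longlongrightarrow> l) at_top" and lim': "((\<lambda>r. r * deriv \<rho> r * ln r) \<longlongrightarrow> 0) at_top"
  defines "g \<equiv> (\<lambda>t. t * \<rho> (exp t))"
  obtains T where "\<And>s t. T \<le> s \<Longrightarrow> s \<le> t \<Longrightarrow> l / 2 * (t - s) \<le> g t - g s"
    and "\<And>s t. T \<le> s \<Longrightarrow> s \<le> t \<Longrightarrow> g t - g s \<le> 2 * l * (t - s)"
proof -
  define g' where "g' t = \<rho> (exp t) + exp t * deriv \<rho> (exp t) * t" for t
  have deriv: "(g has_real_derivative g' t) (at t)" for t
  proof -
    have "\<rho> differentiable (at (exp t))"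
      using C1 by (simp add: C1_differentiable_on_eq)
    then have "(\<rho> has_real_derivative deriv \<rho> (exp t)) (at (exp t))"
      by (simp add: DERIV_deriv_iff_real_differentiable)
    from DERIV_chain2[OF this DERIV_exp]
    have "((\<lambda>t. \<rho> (exp t)) has_real_derivative deriv \<rho> (exp t) * exp t) (at t)" .
    from DERIV_mult[OF DERIV_ident this] show ?thesis
      by (simp add: g_def g'_def algebra_simps)
  qed
  have "(g' \<longlongrightarrow> l + 0) at_top"
    unfolding g'_def
    using filterlim_compose[OF lim exp_at_top] filterlim_compose[OF lim' exp_at_top]
    by (intro tendsto_add) simp_all
  then have "\<forall>\<^sub>F t in at_top. l / 2 < g' t \<and> g' t < 2 * l"
    using \<open>0 < l\<close> by (intro eventually_conj order_tendstoD(1)[of g'] order_tendstoD(2)[of g']) auto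
  then obtain T where T: "\<And>t. T \<le> t \<Longrightarrow> l / 2 < g' t \<and> g' t < 2 * l"
    by (auto simp: eventually_at_top_linorder)
  have bounds: "l / 2 * (t - s) \<le> g t - g s \<and> g t - g s \<le> 2 * l * (t - s)" if "T \<le> s" "s \<le> t" for s t
  proof (cases "s = t")
    case False
    with that MVT2[of s t g g'] deriv obtain z where "s < z" "g t - g s = (t - s) * g' z"
      by auto
    then show ?thesis
      using T[of z] that mult_left_mono[of "l / 2" "g' z" "t - s"] mult_left_mono[of "g' z" "2 * l" "t - s"]
      by (simp add: mult.commute)
  qed simp
  show ?thesis
    using that bounds by blast
qed

section \<open>Membership in the class\<close>

theorem proposition1p12:
  fixes f :: "complex^'n \<Rightarrow> complex" and \<rho> :: "real \<Rightarrow> real"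
  assumes "is_entire f"
    and "0 < growth_order f" and "growth_order f < \<infinity>"
    and "proximate_order f \<rho>"
    and "0 < Liminf at_top (\<lambda>r. ereal (log_max_modulus f r / r powr \<rho> r))"
  shows "f \<in> class_C"
proof -
  obtain l where l: "growth_order f = ereal l" "0 < l"
    using assms(2,3) by (cases "growth_order f") auto
  define g where "g = (\<lambda>t. t * \<rho> (exp t))"
  have \<rho>: "\<rho> C1_differentiable_on {0<..}" "(\<rho> \<longlongrightarrow> l) at_top" "((\<lambda>r. r * deriv \<rho> r * ln r) \<longlongrightarrow> 0) at_top"
    using assms(4) l by (auto simp: proximate_order_def)
  obtain T where T: "\<And>s t. T \<le> s \<Longrightarrow> s \<le> t \<Longrightarrow> l / 2 * (t - s) \<le> g t - g s"
      "\<And>s t. T \<le> s \<Longrightarrow> s \<le> t \<Longrightarrow> g t - g s \<le> 2 * l * (t - s)"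
    using proximate_exponent_increments[OF \<rho>(1) l(2) \<rho>(2,3)] unfolding g_def by blast

  obtain c where c: "0 < c" "ereal c < Liminf at_top (\<lambda>r. ereal (log_max_modulus f r / r powr \<rho> r))"
    using ereal_dense2[OF assms(5)] by auto
  have "Limsup at_top (\<lambda>r. ereal (log_max_modulus f r / r powr \<rho> r)) < \<infinity>"
    using assms(4) by (simp add: proximate_order_def)
  then obtain C where C: "Limsup at_top (\<lambda>r. ereal (log_max_modulus f r / r powr \<rho> r)) < ereal C"
    using ereal_dense2 by blast
  have powr: "exp t powr \<rho> (exp t) = exp (g t)" for t
    by (simp add: powr_def g_def mult.commute)
  have "\<forall>\<^sub>F r in at_top. c < log_max_modulus f r / r powr \<rho> r \<and> log_max_modulus f r / r powr \<rho> r < C"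
    using less_LiminfD[OF c(2)] Limsup_lessD[OF C] by eventually_elim simp
  from eventually_compose_filterlim[OF this exp_at_top]
  have "\<forall>\<^sub>F t in at_top. c * exp (g t) \<le> phi f t \<and> phi f t \<le> C * exp (g t)"
    by eventually_elim (simp add: powr phi_def field_simps)
  then obtain T' where T': "\<And>t. T' \<le> t \<Longrightarrow> c * exp (g t) \<le> phi f t"
      "\<And>t. T' \<le> t \<Longrightarrow> phi f t \<le> C * exp (g t)"
    by (auto simp: eventually_at_top_linorder)
  \<comment> \<open>Beyond \<open>T0\<close> the bounds on \<open>g\<close> and on
    \<open>phi f\<close> both hold; \<open>0 \<le> T0\<close> serves the polynomial
    estimate.\<close>
  define T0 where "T0 = max 0 (max T T')"
  have T0: "0 \<le> T0" "T \<le> T0" "T' \<le> T0"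
    by (auto simp: T0_def)
  have phi_pos: "0 < phi f t" if "T0 \<le> t" for t
    using T'(1)[of t] that T0 c by (smt (verit) exp_gt_zero mult_pos_pos)
  have M_pos: "0 < max_modulus f (exp t)" if "T0 \<le> t" for t
  proof -
    \<comment> \<open>Since \<open>ln 0 = 0\<close>, a vanishing maximum modulus would give
      \<open>phi f t = 0\<close>.\<close>
    have "max_modulus f (exp t) \<noteq> 0"
      using phi_pos[OF that] by (auto simp: phi_def log_max_modulus_def)
    then show ?thesis
      using max_modulus_nonneg[OF assms(1), of "exp t"] by simp
  qed
  have "0 < C"
    using T'(2)[of T0] T0 phi_pos[of T0] by (smt (verit) exp_gt_zero mult_nonneg_nonneg zero_less_mult_iff)
  have g_ge: "g T0 + l / 2 * (t - T0) \<le> g t" if "T0 \<le> t" for t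
    using T(1)[of T0 t] that T0 by simp

  \<comment> \<open>A polynomial would make \<open>phi f\<close> at most linear, whereas it grows at
    least exponentially in \<open>t\<close>.\<close>
  have "\<not> is_polynomial f"
  proof
    assume "is_polynomial f"
    from is_polynomial_phi_le[OF assms(1) this]
    obtain K d where Kd: "\<And>t. 0 \<le> t \<Longrightarrow> 0 < max_modulus f (exp t) \<Longrightarrow> phi f t \<le> K + d * t"
      by blast
    have "\<forall>\<^sub>F t in at_top. K + d * t < c * exp (g T0 + l / 2 * (t - T0))"
      using c(1) l(2) by real_asymp
    moreover have "\<forall>\<^sub>F t in at_top. T0 \<le> t"
      by (rule eventually_ge_at_top)
    ultimately have "\<forall>\<^sub>F t::real in at_top. False"
    proof eventually_elim
      case (elim t)
      have "c * exp (g T0 + l / 2 * (t - T0)) \<le> c * exp (g t)"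
        using g_ge[of t] elim c by simp
      also have "\<dots> \<le> K + d * t"
        using T'(1)[of t] Kd[of t] M_pos[of t] elim T0 by auto
      finally show ?case
        using elim by simp
    qed
    then show False
      by simp
  qed
  moreover have "class_C_I f"
  proof -
    \<comment> \<open>Going back \<open>k\<close> units shrinks \<open>exp (g t)\<close> by at least
      \<open>exp (- l * k / 2)\<close>; \<open>k\<close> is chosen so that
      \<open>phi f (t - k)\<close> is at most half the lower bound
      \<open>c * exp (g t)\<close>.\<close>
    have "((\<lambda>k. C * exp (- (l / 2 * real k))) \<longlongrightarrow> 0) sequentially"
      using l(2) by real_asymp
    then have "\<forall>\<^sub>F k in sequentially. C * exp (- (l / 2 * real k)) < c / 2"
      by (rule order_tendstoD) (use c(1) in simp)
    then obtain k where k: "C * exp (- (l / 2 * real k)) < c / 2" "0 < k"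
      using eventually_gt_at_top[of "0::nat"] by (metis (mono_tags, lifting) eventually_conj eventually_happens sequentially_bot)
    \<comment> \<open>The numerator will be at most \<open>C * exp (2 * l) * exp (g t)\<close>, the
      denominator at least \<open>c / (4 * k) * exp (g t)\<close>.\<close>
    define B where "B = C * exp (2 * l) / (c / (4 * real k))"
    \<comment> \<open>For large \<open>t\<close> the rounding loss of 1 uses up at most half of the
      slope \<open>c / (2 * k) * exp (g t)\<close>; hence the factor 4.\<close>
    have "\<forall>\<^sub>F t in at_top. 1 \<le> c / (4 * real k) * exp (g T0 + l / 2 * (t - T0))"
      using c(1) l(2) k(2) by real_asymp
    moreover have "\<forall>\<^sub>F t in at_top. T0 + real k \<le> t"
      by (rule eventually_ge_at_top)
    ultimately have "\<forall>\<^sub>F t in at_top. (phi f (t + 1) - phi f t) / (phi f t - phi f (t - 1)) \<le> B"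
    proof eventually_elim
      case (elim t)
      have t: "T0 \<le> t" "T0 \<le> t - real k"
        using elim by auto
      have "1 \<le> c / (4 * real k) * exp (g T0 + l / 2 * (t - T0))"
        using elim by simp
      also have "\<dots> \<le> c / (4 * real k) * exp (g t)"
        using g_ge[OF t(1)] c by (intro mult_left_mono) auto
      finally have one: "1 \<le> c / (4 * real k) * exp (g t)" .

      have "phi f (t - real k) \<le> C * exp (g (t - real k))"
        using t T0 by (intro T'(2)) simp
      also have "\<dots> \<le> C * exp (g t - l / 2 * real k)"
        using T(1)[of "t - real k" t] t T0 \<open>0 < C\<close> by simp
      also have "\<dots> = C * exp (- (l / 2 * real k)) * exp (g t)"
        by (simp add: mult.assoc flip: exp_add)
      also have "\<dots> \<le> c / 2 * exp (g t)"
        using k(1) by (intro mult_right_mono) auto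
      finally have "c / 2 * exp (g t) \<le> phi f t - phi f (t - real k)"
        using T'(1)[of t] t T0 by simp
      then have "c / 2 * exp (g t) / real k - 1 \<le> (phi f t - phi f (t - real k)) / real k - 1"
        by (intro diff_right_mono divide_right_mono) auto
      also have "\<dots> \<le> phi f t - phi f (t - 1)"
        using assms(1) M_pos[OF t(2)] k(2) by (rule phi_increment_ge)
      finally have den: "c / (4 * real k) * exp (g t) \<le> phi f t - phi f (t - 1)"
        using one by (simp add: field_simps)

      have "phi f (t + 1) - phi f t \<le> phi f (t + 1)"
        using phi_pos[OF t(1)] by simp
      also have "\<dots> \<le> C * exp (g (t + 1))"
        using t T0 by (intro T'(2)) simp
      also have "\<dots> \<le> C * exp (g t + 2 * l)"
        using T(2)[of t "t + 1"] t T0 \<open>0 < C\<close> by simp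
      also have "\<dots> = B * (c / (4 * real k) * exp (g t))"
        using c(1) k(2) by (simp add: B_def exp_add)
      also have "\<dots> \<le> B * (phi f t - phi f (t - 1))"
        using den \<open>0 < C\<close> c(1) by (intro mult_left_mono) (auto simp: B_def)
      finally show ?case
        \<comment> \<open>By \<open>den\<close> and \<open>one\<close> the denominator is at least
          1, so the division is legitimate.\<close>
        using den one by (subst pos_divide_le_eq) linarith+
    qed
    then have "Limsup at_top (\<lambda>t. ereal ((phi f (t + 1) - phi f t) / (phi f t - phi f (t - 1)))) \<le> ereal B"
      by (intro Limsup_bounded) simp
    also have "\<dots> < \<infinity>"
      by simp
    finally show ?thesis
      using assms(3) by (simp add: class_C_I_def)
  qed
  ultimately show ?thesis
    using assms(1) by (simp add: class_C_def)
qed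

end
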